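(* For every morphism $t \in \mathbf{Cliff}(1,1)$ (a single-qubit Clifford circuit) there is a diagram $c \in \mathfrak{C}_1$ such that $T(t) \stackrel{*}{\leftrightarrow} c$.
   Context: **ZX-diagrams.** A ZX-diagram $D:m\to n$ is a finite undirected open graph (edges may have open ends) whose open ends are partitioned into a linearly ordered list of $m$ inputs (drawn on the left) and a linearly ordered list of $n$ outputs (drawn on the right), with interior vertices of three kinds: $Z(\alpha)$ (green) and $X(\beta)$ (red) vertices of arbitrary degree, labelled by angles in $[0,2\pi)$ (arithmetic modulo $2\pi$), and $H$ vertices of degree exactly 2. Two diagrams are equal if they are isomorphic as labelled framed open graphs. Diagrams compose ($\circ$, joining outputs to inputs) and tensor ($\otimes$, juxtaposition), forming a PROP $\mathbf{ZX}$ with swap $\sigma:2\to 2$. $\mathbf{ZX_s}$ is the sub-PROP of diagrams with all angles in $\{0,\pi/2,\pi,3\pi/2\}$. **Equivalence.** $\stackrel{*}{\leftrightarrow}$ is the least equivalence relation on diagrams containing one-step replacement of a subdiagram using the following rules and their colour-swapped ($Z\leftrightarrow X$) versions, applicable in either direction. Everything is taken up to non-zero scalars, i.e. non-zero subdiagrams without boundary are ignored. - spider: two $Z$ vertices $Z(\alpha),Z(\beta)$ joined by an edge merge into one vertex $Z(\alpha+\beta)$; - anti-loop: a self-loop on a $Z(\alpha)$ vertex may be deleted; - identity: a degree-2 vertex $Z(0)$ equals a plain wire; - copying: $(Z(0):1\to2)\circ(X(0):0\to1)\leftrightarrow (X(0):0\to 1)\otimes (X(0):0\to1)$; - $\pi$-commute: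 $(Z(\alpha):1\to n)\circ (X(\pi):1\to1)\leftrightarrow (X(\pi):1\to 1)^{\otimes n}\circ (Z(-\alpha):1\to n)$; - hopf: $(X(0):2\to1)\circ(Z(0):1\to2)\leftrightarrow (X(0):0\to1)\circ(Z(0):1\to0)$; - bialgebra: $(Z(0):1\to2)\circ(X(0):2\to1)\leftrightarrow (X(0)\otimes X(0))\circ(\mathrm{id}\otimes\sigma\otimes \mathrm{id})\circ(Z(0)\otimes Z(0))$, with $Z(0):1\to2$ and $X(0):2\to1$ on the right; - $H$-commute: a $Z(\alpha)$ vertex with an $H$ on every leg equals an $X(\alpha)$ vertex; - $H$-euler: $H\leftrightarrow Z(\pi/2)\circ X(\pi/2)\circ Z(\pi/2)$. In $\mathbf{ZX_s}$ the angles in these rules are restricted to multiples of $\pi/2$. **One-qubit notation.** $z_+,z,z_-$ denote the $1\to1$ diagrams consisting of a single vertex $Z(\pi/2),Z(\pi),Z(3\pi/2)$ respectively, and $x_+,x,x_-$ those consisting of $X(\pi/2),X(\pi),X(3\pi/2)$. A word such as $[z_+,x_-]$ denotes the line diagram whose vertices are, read from input to output, $z_+$ then $x_-$. **Clifford circuits.** $\mathbf{Cliff}$ is the free $\dagger$-PROP (so no non-trivial equations are imposed between circuits) generated by $S,V,Z,X,H:1\to1$ and $\mathrm{CNOT}:2\to2$. The PROP functor $T:\mathbf{Cliff}\to\mathbf{ZX_s}$ is given by $S\mapsto z_+$, $V\mapsto x_+$, $Z\mapsto z$, $X\mapsto x$, $H\mapsto$ the $H$ vertex, and $\mathrm{CNOT}\mapsto$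 the $2\to 2$ diagram with a $Z(0)$ vertex on the first wire joined by an edge to an $X(0)$ vertex on the second wire. The dagger reflects a ZX-diagram (exchanging inputs and outputs) and negates its angles. **The set $\mathfrak{C}_1$** consists of the following 24 line diagrams: the plain wire; $[z_+],[z],[z_-],[x_+],[x],[x_-]$; $[z,x],[z,x_-],[z,x_+],[x,z_-],[x,z_+]$; $[z_-,x_-],[z_-,x_+],[z_+,x_-],[z_+,x_+],[x_-,z_-],[x_-,z_+],[x_+,z_-],[x_+,z_+]$; $[z_+,x_-,z_-],[z_+,x_-,z_+],[z_+,x_+,z_-],[z_+,x_+,z_+]$. *)

theory Defs
  imports Complex_Main "HOL-Library.Multiset" "HOL-Library.Nat_Bijection"
begin

section \<open>Angles\<close>

text \<open>Angles are real numbers modulo \<open>2\<pi>\<close>; each class has exactly one representative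
  in \<open>[0, 2\<pi>)\<close>.\<close>

definition angle_rel :: "real \<Rightarrow> real \<Rightarrow> bool" where
  "angle_rel x y \<longleftrightarrow> (\<exists>k::int. x - y = 2 * pi * of_int k)"

lemma equivp_angle_rel: "equivp angle_rel"
proof (rule equivpI)
  show "reflp angle_rel"
    unfolding reflp_def angle_rel_def by (auto intro: exI[of _ "0::int"])
  show "symp angle_rel"
  proof (rule sympI)
    fix x y assume "angle_rel x y"
    then obtain k :: int where "x - y = 2 * pi * of_int k"
      unfolding angle_rel_def by blast
    hence "y - x = 2 * pi * of_int (- k)" by simp
    thus "angle_rel y x" unfolding angle_rel_def by blast
  qed
  show "transp angle_rel"
  proof (rule transpI)
    fix x y z assume "angle_rel x y" "angle_rel y z"
    then obtain k l :: int where "x - y = 2 * pi * of_int k" "y - z = 2 * pi * of_int l"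
      unfolding angle_rel_def by blast
    hence "x - z = 2 * pi * of_int (k + l)" by (simp add: algebra_simps)
    thus "angle_rel x z" unfolding angle_rel_def by blast
  qed
qed

quotient_type angle = real / angle_rel
  by (rule equivp_angle_rel)

lift_definition angle :: "real \<Rightarrow> angle" is "\<lambda>x. x" .

lift_definition cis_angle :: "angle \<Rightarrow> complex" is cis
proof -
  fix x y assume "angle_rel x y"
  then obtain k :: int where "x - y = 2 * pi * of_int k"
    unfolding angle_rel_def by blast
  hence "x = y + 2 * pi * of_int k" by simp
  hence "cis x = cis y * cis (2 * pi * of_int k)" by (simp only: cis_mult)
  also have "cis (2 * pi * of_int k) = 1" by (rule cis_multiple_2pi) simp
  finally show "cis x = cis y" by simp
qed

instantiation angle :: ab_group_add
begin

lift_definition zero_angle :: angle is 0 .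

lift_definition plus_angle :: "angle \<Rightarrow> angle \<Rightarrow> angle" is "(+)"
proof -
  fix a b c d assume "angle_rel a b" "angle_rel c d"
  then obtain k l :: int where "a - b = 2 * pi * of_int k" "c - d = 2 * pi * of_int l"
    unfolding angle_rel_def by blast
  hence "(a + c) - (b + d) = 2 * pi * of_int (k + l)" by (simp add: algebra_simps)
  thus "angle_rel (a + c) (b + d)" unfolding angle_rel_def by blast
qed

lift_definition uminus_angle :: "angle \<Rightarrow> angle" is uminus
proof -
  fix a b assume "angle_rel a b"
  then obtain k :: int where "a - b = 2 * pi * of_int k"
    unfolding angle_rel_def by blast
  hence "(- a) - (- b) = 2 * pi * of_int (- k)" by simp
  thus "angle_rel (- a) (- b)" unfolding angle_rel_def by blast
qed

definition minus_angle :: "angle \<Rightarrow> angle \<Rightarrow> angle" where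
  "minus_angle a b = a + (- b)"

instance
proof
  fix a b c :: angle
  have refl: "angle_rel x x" for x by (rule equivp_reflp[OF equivp_angle_rel])
  show "a + b + c = a + (b + c)" by transfer (simp add: add.assoc refl)
  show "a + b = b + a" by transfer (simp add: add.commute refl)
  show "0 + a = a" by transfer (simp add: refl)
  show "- a + a = 0" by transfer (simp add: refl)
  show "a - b = a + - b" by (rule minus_angle_def)
qed

end

definition clifford_angles :: "angle set" where
  "clifford_angles = {angle 0, angle (pi/2), angle pi, angle (3*pi/2)}"


section \<open>ZX-diagrams\<close>

datatype vlabel = ZV angle | XV angle | HV

text \<open>A diagram is an open multigraph. The multiset \<open>legs D v\<close> lists the edges incident to the
  vertex \<open>v\<close>, a self-loop occurring twice in it. The inputs and outputs are open ends of edges;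
  each is given by the edge it is an end of, so that a plain wire occurs twice in
  \<open>ins D @ outs D\<close>. Vertex and edge names are immaterial (see \<open>zx_iso\<close> below).\<close>

record diagram =
  verts :: "nat set"
  label :: "nat \<Rightarrow> vlabel"
  edges :: "nat set"
  legs :: "nat \<Rightarrow> nat multiset"
  ins :: "nat list"
  outs :: "nat list"

definition ends :: "diagram \<Rightarrow> nat \<Rightarrow> nat" where
  "ends D e = (\<Sum>v\<in>verts D. count (legs D v) e) + count_list (ins D) e + count_list (outs D) e"

fun label_over :: "angle set \<Rightarrow> vlabel \<Rightarrow> bool" where
  "label_over \<Phi> (ZV \<alpha>) \<longleftrightarrow> \<alpha> \<in> \<Phi>"
| "label_over \<Phi> (XV \<alpha>) \<longleftrightarrow> \<alpha> \<in> \<Phi>"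
| "label_over \<Phi> HV \<longleftrightarrow> True"

text \<open>The diagrams \<open>m \<rightarrow> n\<close> with all angles in \<open>\<Phi>\<close>. Every edge has two ends, except that
  composing diagrams may close up wires to circles without any vertex, which have no end.\<close>

definition ZX_over :: "angle set \<Rightarrow> nat \<Rightarrow> nat \<Rightarrow> diagram set" where
  "ZX_over \<Phi> m n = {D.
     finite (verts D) \<and> finite (edges D) \<and>
     (\<forall>v\<in>verts D. set_mset (legs D v) \<subseteq> edges D) \<and>
     set (ins D) \<subseteq> edges D \<and> set (outs D) \<subseteq> edges D \<and>
     (\<forall>e\<in>edges D. ends D e \<in> {0, 2}) \<and>
     (\<forall>v\<in>verts D. label_over \<Phi> (label D v)) \<and>
     (\<forall>v\<in>verts D. label D v = HV \<longrightarrow> size (legs D v) = 2) \<and>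
     length (ins D) = m \<and> length (outs D) = n}"

abbreviation ZX :: "nat \<Rightarrow> nat \<Rightarrow> diagram set" where
  "ZX \<equiv> ZX_over UNIV"

abbreviation ZX\<^sub>s :: "nat \<Rightarrow> nat \<Rightarrow> diagram set" where
  "ZX\<^sub>s \<equiv> ZX_over clifford_angles"

text \<open>Equality of diagrams is isomorphism of labelled framed open graphs.\<close>

definition zx_iso :: "diagram \<Rightarrow> diagram \<Rightarrow> bool" (infix "\<cong>" 50) where
  "D \<cong> D' \<longleftrightarrow> (\<exists>f g.
     bij_betw f (verts D) (verts D') \<and> bij_betw g (edges D) (edges D') \<and>
     (\<forall>v\<in>verts D. label D' (f v) = label D v \<and> legs D' (f v) = image_mset g (legs D v)) \<and>
     ins D' = map g (ins D) \<and> outs D' = map g (outs D))"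


subsection \<open>The PROP structure\<close>

abbreviation inl :: "nat \<Rightarrow> nat" where "inl n \<equiv> sum_encode (Inl n)"
abbreviation inr :: "nat \<Rightarrow> nat" where "inr n \<equiv> sum_encode (Inr n)"

definition zx_tensor :: "diagram \<Rightarrow> diagram \<Rightarrow> diagram" (infixr "\<otimes>" 70) where
  "D \<otimes> E = \<lparr>
     verts = inl ` verts D \<union> inr ` verts E,
     label = (\<lambda>v. case sum_decode v of Inl u \<Rightarrow> label D u | Inr u \<Rightarrow> label E u),
     edges = inl ` edges D \<union> inr ` edges E,
     legs = (\<lambda>v. case sum_decode v of
                   Inl u \<Rightarrow> image_mset inl (legs D u)
                 | Inr u \<Rightarrow> image_mset inr (legs E u)),
     ins = map inl (ins D) @ map inr (ins E),
     outs = map inl (outs D) @ map inr (outs E)\<rparr>"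

text \<open>Composition \<open>E \<odot> D\<close> (first \<open>D\<close>, then \<open>E\<close>) identifies, in the disjoint union, the edge ending
  in the \<open>i\<close>-th output of \<open>D\<close> with the one ending in the \<open>i\<close>-th input of \<open>E\<close>. An edge of the
  composite is a class of identified edges, named by its least element.\<close>

definition glue :: "diagram \<Rightarrow> diagram \<Rightarrow> nat \<Rightarrow> nat \<Rightarrow> bool" where
  "glue E D = equivclp (\<lambda>e e'. (e, e') \<in> set (zip (map inl (outs D)) (map inr (ins E))))"

definition glue_rep :: "diagram \<Rightarrow> diagram \<Rightarrow> nat \<Rightarrow> nat" where
  "glue_rep E D e = (LEAST e'. glue E D e e')"

definition zx_comp :: "diagram \<Rightarrow> diagram \<Rightarrow> diagram" (infixr "\<odot>" 65) where
  "E \<odot> D = \<lparr>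
     verts = verts (D \<otimes> E),
     label = label (D \<otimes> E),
     edges = glue_rep E D ` edges (D \<otimes> E),
     legs = (\<lambda>v. image_mset (glue_rep E D) (legs (D \<otimes> E) v)),
     ins = map (glue_rep E D) (map inl (ins D)),
     outs = map (glue_rep E D) (map inr (outs E))\<rparr>"

definition zx_id :: "nat \<Rightarrow> diagram" where
  "zx_id n = \<lparr>verts = {}, label = (\<lambda>_. HV), edges = {..<n}, legs = (\<lambda>_. {#}),
     ins = [0..<n], outs = [0..<n]\<rparr>"

definition zx_swap :: diagram where
  "zx_swap = \<lparr>verts = {}, label = (\<lambda>_. HV), edges = {0, 1}, legs = (\<lambda>_. {#}),
     ins = [0, 1], outs = [1, 0]\<rparr>"

text \<open>The single edge with both ends taken as inputs.\<close>

definition zx_cap :: diagram where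
  "zx_cap = \<lparr>verts = {}, label = (\<lambda>_. HV), edges = {0}, legs = (\<lambda>_. {#}),
     ins = [0, 0], outs = []\<rparr>"

primrec zx_pow :: "diagram \<Rightarrow> nat \<Rightarrow> diagram" where
  "zx_pow D 0 = zx_id 0"
| "zx_pow D (Suc n) = D \<otimes> zx_pow D n"

definition vertex :: "vlabel \<Rightarrow> nat \<Rightarrow> nat \<Rightarrow> diagram" where
  "vertex l m n = \<lparr>verts = {0}, label = (\<lambda>_. l), edges = {..<m+n}, legs = (\<lambda>_. mset [0..<m+n]),
     ins = [0..<m], outs = [m..<m+n]\<rparr>"

abbreviation Zd :: "angle \<Rightarrow> nat \<Rightarrow> nat \<Rightarrow> diagram" where "Zd \<alpha> \<equiv> vertex (ZV \<alpha>)"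
abbreviation Xd :: "angle \<Rightarrow> nat \<Rightarrow> nat \<Rightarrow> diagram" where "Xd \<alpha> \<equiv> vertex (XV \<alpha>)"
abbreviation Hd :: diagram where "Hd \<equiv> vertex HV 1 1"

fun negate_label :: "vlabel \<Rightarrow> vlabel" where
  "negate_label (ZV \<alpha>) = ZV (- \<alpha>)"
| "negate_label (XV \<alpha>) = XV (- \<alpha>)"
| "negate_label HV = HV"

definition zx_dagger :: "diagram \<Rightarrow> diagram" where
  "zx_dagger D = D\<lparr>label := negate_label \<circ> label D, ins := outs D, outs := ins D\<rparr>"


subsection \<open>Scalars\<close>

text \<open>\<open>vertex_weight l d k\<close> is the matrix entry, under the standard interpretation, of a vertex of
  degree \<open>d\<close> labelled \<open>l\<close>, when \<open>k\<close> of its legs carry the basis state 1 and the others carry 0. For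
  \<open>Z(\<alpha>)\<close> this comes from \<open>|0..0> + e\<^sup>i\<^sup>\<alpha> |1..1>\<close> and for \<open>X(\<alpha>)\<close> from \<open>|+..+> + e\<^sup>i\<^sup>\<alpha> |-..->\<close>.\<close>

fun vertex_weight :: "vlabel \<Rightarrow> nat \<Rightarrow> nat \<Rightarrow> complex" where
  "vertex_weight (ZV \<alpha>) d k = (if k = 0 then 1 else 0) + (if k = d then cis_angle \<alpha> else 0)"
| "vertex_weight (XV \<alpha>) d k = (1 + (-1) ^ k * cis_angle \<alpha>) / of_real (sqrt 2) ^ d"
| "vertex_weight HV d k = (if k = 2 then -1 else 1) / of_real (sqrt 2)"

text \<open>The complex number denoted by a diagram without boundary: \<open>S\<close> ranges over the possible sets
  of edges carrying the basis state 1.\<close>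

definition scalar_value :: "diagram \<Rightarrow> complex" where
  "scalar_value D = (\<Sum>S\<in>Pow (edges D). \<Prod>v\<in>verts D.
     vertex_weight (label D v) (size (legs D v)) (size {#e \<in># legs D v. e \<in> S#}))"


section \<open>Equivalence of diagrams\<close>

inductive zx_rule :: "angle set \<Rightarrow> diagram \<Rightarrow> diagram \<Rightarrow> bool" for \<Phi> where
  spider: "\<alpha> \<in> \<Phi> \<Longrightarrow> \<beta> \<in> \<Phi> \<Longrightarrow>
    zx_rule \<Phi> (Zd \<beta> 1 n \<odot> Zd \<alpha> m 1) (Zd (\<alpha> + \<beta>) m n)"
| anti_loop: "\<alpha> \<in> \<Phi> \<Longrightarrow>
    zx_rule \<Phi> (zx_cap \<odot> Zd \<alpha> n 2) (Zd \<alpha> n 0)"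
| identity: "zx_rule \<Phi> (Zd 0 1 1) (zx_id 1)"
| copying: "zx_rule \<Phi> (Zd 0 1 2 \<odot> Xd 0 0 1) (Xd 0 0 1 \<otimes> Xd 0 0 1)"
| pi_commute: "\<alpha> \<in> \<Phi> \<Longrightarrow>
    zx_rule \<Phi> (Zd \<alpha> 1 n \<odot> Xd (angle pi) 1 1)
              (zx_pow (Xd (angle pi) 1 1) n \<odot> Zd (- \<alpha>) 1 n)"
| hopf: "zx_rule \<Phi> (Xd 0 2 1 \<odot> Zd 0 1 2) (Xd 0 0 1 \<odot> Zd 0 1 0)"
| bialgebra: "zx_rule \<Phi> (Zd 0 1 2 \<odot> Xd 0 2 1)
    ((Xd 0 2 1 \<otimes> Xd 0 2 1) \<odot> (zx_id 1 \<otimes> zx_swap \<otimes> zx_id 1) \<odot> (Zd 0 1 2 \<otimes> Zd 0 1 2))"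
| H_commute: "\<alpha> \<in> \<Phi> \<Longrightarrow>
    zx_rule \<Phi> (zx_pow Hd n \<odot> Zd \<alpha> m n \<odot> zx_pow Hd m) (Xd \<alpha> m n)"
| H_euler: "zx_rule \<Phi> Hd (Zd (angle (pi/2)) 1 1 \<odot> Xd (angle (pi/2)) 1 1 \<odot> Zd (angle (pi/2)) 1 1)"
| scalar: "s \<in> ZX_over \<Phi> 0 0 \<Longrightarrow> scalar_value s \<noteq> 0 \<Longrightarrow> zx_rule \<Phi> s (zx_id 0)"

fun swap_colour :: "vlabel \<Rightarrow> vlabel" where
  "swap_colour (ZV \<alpha>) = XV \<alpha>"
| "swap_colour (XV \<alpha>) = ZV \<alpha>"
| "swap_colour HV = HV"

definition colour_swap :: "diagram \<Rightarrow> diagram" where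
  "colour_swap D = D\<lparr>label := swap_colour \<circ> label D\<rparr>"

text \<open>Replacement of a subdiagram \<open>L : p \<rightarrow> q\<close> by \<open>R : p \<rightarrow> q\<close>. Edges of a diagram may join two
  inputs or two outputs, so every way in which \<open>L\<close> can sit inside a diagram is of the form
  \<open>B \<odot> (L \<otimes> zx_id k) \<odot> A\<close>.\<close>

definition zx_step :: "angle set \<Rightarrow> diagram \<Rightarrow> diagram \<Rightarrow> bool" where
  "zx_step \<Phi> D D' \<longleftrightarrow> (\<exists>L R A B k m n p q.
     (zx_rule \<Phi> L R \<or> (\<exists>L' R'. zx_rule \<Phi> L' R' \<and> L = colour_swap L' \<and> R = colour_swap R')) \<and>
     length (ins L) = p \<and> length (outs L) = q \<and>
     A \<in> ZX_over \<Phi> m (p + k) \<and> B \<in> ZX_over \<Phi> (q + k) n \<and>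
     D \<cong> B \<odot> (L \<otimes> zx_id k) \<odot> A \<and>
     D' \<cong> B \<odot> (R \<otimes> zx_id k) \<odot> A)"

definition zx_equiv :: "angle set \<Rightarrow> diagram \<Rightarrow> diagram \<Rightarrow> bool" where
  "zx_equiv \<Phi> = equivclp (\<lambda>D D'. D \<cong> D' \<or> zx_step \<Phi> D D')"

abbreviation zxs_equiv :: "diagram \<Rightarrow> diagram \<Rightarrow> bool" (infix "\<leftrightarrow>\<^sup>*" 50) where
  "D \<leftrightarrow>\<^sup>* D' \<equiv> zx_equiv clifford_angles D D'"


section \<open>Clifford circuits\<close>

text \<open>Morphisms of the free \<open>\<dagger>\<close>-PROP are represented by terms over its generators; every morphism
  \<open>m \<rightarrow> n\<close> is represented by some term of that type. Two terms equal by the axioms of a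
  \<open>\<dagger>\<close>-PROP represent the same morphism, and are sent by \<open>T\<close> to isomorphic diagrams.\<close>

datatype cliff =
    S_gate | V_gate | Z_gate | X_gate | H_gate | CNOT
  | Id nat
  | Swap
  | Comp cliff cliff  (* Comp g f: first f, then g *)
  | Tensor cliff cliff
  | Dagger cliff

inductive cliff_type :: "cliff \<Rightarrow> nat \<Rightarrow> nat \<Rightarrow> bool" where
  "cliff_type S_gate 1 1"
| "cliff_type V_gate 1 1"
| "cliff_type Z_gate 1 1"
| "cliff_type X_gate 1 1"
| "cliff_type H_gate 1 1"
| "cliff_type CNOT 2 2"
| "cliff_type (Id n) n n"
| "cliff_type Swap 2 2"
| "cliff_type f m n \<Longrightarrow> cliff_type g n p \<Longrightarrow> cliff_type (Comp g f) m p"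
| "cliff_type f m n \<Longrightarrow> cliff_type g p q \<Longrightarrow> cliff_type (Tensor f g) (m + p) (n + q)"
| "cliff_type f m n \<Longrightarrow> cliff_type (Dagger f) n m"

definition Cliff :: "nat \<Rightarrow> nat \<Rightarrow> cliff set" where
  "Cliff m n = {t. cliff_type t m n}"

abbreviation z_plus :: vlabel where "z_plus \<equiv> ZV (angle (pi/2))"
abbreviation z_pi :: vlabel where "z_pi \<equiv> ZV (angle pi)"
abbreviation z_minus :: vlabel where "z_minus \<equiv> ZV (angle (3*pi/2))"
abbreviation x_plus :: vlabel where "x_plus \<equiv> XV (angle (pi/2))"
abbreviation x_pi :: vlabel where "x_pi \<equiv> XV (angle pi)"
abbreviation x_minus :: vlabel where "x_minus \<equiv> XV (angle (3*pi/2))"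

definition zx_cnot :: diagram where
  "zx_cnot = \<lparr>verts = {0, 1}, label = (\<lambda>v. if v = 0 then ZV 0 else XV 0), edges = {..<5},
     legs = (\<lambda>v. if v = 0 then {#0, 2, 4#} else {#1, 3, 4#}), ins = [0, 1], outs = [2, 3]\<rparr>"

primrec T :: "cliff \<Rightarrow> diagram" where
  "T S_gate = vertex z_plus 1 1"
| "T V_gate = vertex x_plus 1 1"
| "T Z_gate = vertex z_pi 1 1"
| "T X_gate = vertex x_pi 1 1"
| "T H_gate = Hd"
| "T CNOT = zx_cnot"
| "T (Id n) = zx_id n"
| "T Swap = zx_swap"
| "T (Comp g f) = T g \<odot> T f"
| "T (Tensor f g) = T f \<otimes> T g"
| "T (Dagger f) = zx_dagger (T f)"

text \<open>The line diagram with the given vertices from input to output; \<open>line []\<close> is the plain wire.\<close>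

definition line :: "vlabel list \<Rightarrow> diagram" where
  "line ls = \<lparr>verts = {..<length ls}, label = (\<lambda>v. ls ! v), edges = {..length ls},
     legs = (\<lambda>v. {#v, Suc v#}), ins = [0], outs = [length ls]\<rparr>"

definition C\<^sub>1 :: "diagram set" where
  "C\<^sub>1 = line ` {
     [],
     [z_plus], [z_pi], [z_minus], [x_plus], [x_pi], [x_minus],
     [z_pi, x_pi], [z_pi, x_minus], [z_pi, x_plus], [x_pi, z_minus], [x_pi, z_plus],
     [z_minus, x_minus], [z_minus, x_plus], [z_plus, x_minus], [z_plus, x_plus],
     [x_minus, z_minus], [x_minus, z_plus], [x_plus, z_minus], [x_plus, z_plus],
     [z_plus, x_minus, z_minus], [z_plus, x_minus, z_plus], [z_plus, x_plus, z_minus], [z_plus, x_plus, z_plus]}"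

end

theory Submission
  imports Defs
begin

text \<open>A one-qubit circuit is a line diagram, and line diagrams up to rewriting in context form a
  monoid under concatenation. It is generated by \<open>a = [z\<^sub>+]\<close> and \<open>b = [x\<^sub>+]\<close>, because Euler's rule and
  its colour-swapped version give \<open>H = aba = bab\<close>. The spider, identity and \<open>\<pi>\<close>-commute rules say
  that \<open>p = a\<^sup>2\<close> and \<open>q = b\<^sup>2\<close> are involutions with \<open>pb = b\<^sup>3p\<close> and \<open>qa = a\<^sup>3q\<close>. These relations
  bring every word to one of 24 normal forms, a Pauli \<open>1, p, q, pq\<close> followed by
  \<open>1, a, b, ab, ba\<close> or \<open>aba\<close>, and these are the classes of the 24 given lines.\<close>

section \<open>Isomorphism with line diagrams\<close>

lemma zx_iso_refl: "D \<cong> D"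
  unfolding zx_iso_def by (intro exI[of _ id]) (auto simp: bij_betw_def)

lemma zx_iso_trans:
  assumes "D \<cong> E" "E \<cong> F"
  shows "D \<cong> F"
proof -
  obtain f g where fg: "bij_betw f (verts D) (verts E)" "bij_betw g (edges D) (edges E)"
    "\<forall>v\<in>verts D. label E (f v) = label D v \<and> legs E (f v) = image_mset g (legs D v)"
    "ins E = map g (ins D)" "outs E = map g (outs D)"
    using assms(1) unfolding zx_iso_def by blast
  obtain f' g' where fg': "bij_betw f' (verts E) (verts F)" "bij_betw g' (edges E) (edges F)"
    "\<forall>v\<in>verts E. label F (f' v) = label E v \<and> legs F (f' v) = image_mset g' (legs E v)"
    "ins F = map g' (ins E)" "outs F = map g' (outs E)"
    using assms(2) unfolding zx_iso_def by blast
  have "f v \<in> verts E" if "v \<in> verts D" for v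
    using fg(1) that by (auto simp: bij_betw_def)
  then show ?thesis
    unfolding zx_iso_def using fg fg'
    by (intro exI[of _ "f' \<circ> f"] exI[of _ "g' \<circ> g"])
      (auto intro: bij_betw_trans simp: multiset.map_comp)
qed

text \<open>The maps \<open>f\<close> and \<open>g\<close> enumerate the vertices and edges of
  \<open>D\<close> as met on the way from input to output, vertex \<open>k\<close> lying between
  edges \<open>k\<close> and \<open>Suc k\<close>. Working with these enumerations keeps the names
  chosen by composition out of sight.\<close>

lemma line_iso_iff:
  "line ls \<cong> D \<longleftrightarrow> (\<exists>f g. bij_betw f {..<length ls} (verts D) \<and> bij_betw g {..length ls} (edges D) \<and>
     (\<forall>k<length ls. label D (f k) = ls ! k \<and> legs D (f k) = {#g k, g (Suc k)#}) \<and>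
     ins D = [g 0] \<and> outs D = [g (length ls)])"
  unfolding zx_iso_def line_def by auto

lemma length_ins_line_iso: "line ls \<cong> D \<Longrightarrow> length (ins D) = 1"
  and length_outs_line_iso: "line ls \<cong> D \<Longrightarrow> length (outs D) = 1"
  unfolding line_iso_iff by auto

lemma line_iso_vertex: "line [l] \<cong> vertex l 1 1"
  unfolding line_iso_iff vertex_def
  by (intro exI[of _ id]) (auto simp: bij_betw_def numeral_2_eq_2)

lemma line_iso_id: "line [] \<cong> zx_id 1"
  unfolding line_iso_iff zx_id_def
  by (intro exI[of _ id]) (auto simp: bij_betw_def)

lemma line_iso_dagger:
  assumes "line ls \<cong> D"
  shows "line (map negate_label (rev ls)) \<cong> zx_dagger D"
proof -
  let ?n = "length ls"
  obtain f g where fg: "bij_betw f {..<?n} (verts D)" "bij_betw g {..?n} (edges D)"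
    "\<forall>k<?n. label D (f k) = ls ! k \<and> legs D (f k) = {#g k, g (Suc k)#}"
    "ins D = [g 0]" "outs D = [g ?n]"
    using assms unfolding line_iso_iff by blast
  \<comment> \<open>Read backwards, vertex \<open>k\<close> is the old vertex
    \<open>?n - Suc k\<close> but edge \<open>k\<close> is the old edge \<open>?n - k\<close>, since
    a line has one more edge than vertices.\<close>
  have "bij_betw (\<lambda>k. ?n - Suc k) {..<?n} {..<?n}"
    by (rule bij_betw_byWitness[where f' = "\<lambda>k. ?n - Suc k"]) auto
  moreover have "bij_betw (\<lambda>k. ?n - k) {..?n} {..?n}"
    by (rule bij_betw_byWitness[where f' = "\<lambda>k. ?n - k"]) auto
  ultimately have "bij_betw (f \<circ> (\<lambda>k. ?n - Suc k)) {..<?n} (verts D)"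
    "bij_betw (g \<circ> (\<lambda>k. ?n - k)) {..?n} (edges D)"
    using fg bij_betw_trans by blast+
  then show ?thesis
    unfolding line_iso_iff zx_dagger_def using fg
    by (intro exI[of _ "f \<circ> (\<lambda>k. ?n - Suc k)"] exI[of _ "g \<circ> (\<lambda>k. ?n - k)"])
      (auto simp: rev_nth Suc_diff_Suc add_mset_commute)
qed

lemma line_iso_colour_swap:
  assumes "line ls \<cong> D"
  shows "line (map swap_colour ls) \<cong> colour_swap D"
proof -
  obtain f g where "bij_betw f {..<length ls} (verts D)" "bij_betw g {..length ls} (edges D)"
    "\<forall>k<length ls. label D (f k) = ls ! k \<and> legs D (f k) = {#g k, g (Suc k)#}"
    "ins D = [g 0]" "outs D = [g (length ls)]"
    using assms unfolding line_iso_iff by blast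
  then show ?thesis
    unfolding line_iso_iff colour_swap_def by (intro exI[of _ f] exI[of _ g]) simp
qed

text \<open>The identity on 0 wires; \<open>label\<close> and \<open>legs\<close> are left free
  because they carry no meaning off \<open>verts\<close>.\<close>

definition empty_diagram :: "diagram \<Rightarrow> bool" where
  "empty_diagram D \<longleftrightarrow> verts D = {} \<and> edges D = {} \<and> ins D = [] \<and> outs D = []"

lemma empty_diagram_id: "empty_diagram (zx_id 0)"
  by (simp add: empty_diagram_def zx_id_def)

lemma iso_tensor_empty_right: "empty_diagram E \<Longrightarrow> D \<cong> D \<otimes> E"
  unfolding zx_iso_def zx_tensor_def empty_diagram_def
  by (intro exI[of _ "\<lambda>n. inl n"])
    (auto simp: bij_betw_def inj_on_def sum_encode_eq)

lemma iso_tensor_empty_left: "empty_diagram E \<Longrightarrow> D \<cong> E \<otimes> D"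
  unfolding zx_iso_def zx_tensor_def empty_diagram_def
  by (intro exI[of _ "\<lambda>n. inr n"])
    (auto simp: bij_betw_def inj_on_def sum_encode_eq)

text \<open>A class is determined by its least element, so equality of edges in a composite is the
  gluing relation and \<open>LEAST\<close> never has to be computed.\<close>

lemma glue_rep_eq_iff: "glue_rep E D e = glue_rep E D e' \<longleftrightarrow> glue E D e e'"
proof
  have self: "glue E D x (glue_rep E D x)" for x
    unfolding glue_rep_def by (rule LeastI[of _ x]) (simp add: glue_def)
  show "glue E D e e'" if "glue_rep E D e = glue_rep E D e'"
  proof -
    have "glue E D e (glue_rep E D e')"
      using self[of e] that by simp
    moreover have "glue E D (glue_rep E D e') e'"
      using self[of e'] unfolding glue_def by (rule equivclp_sym)
    ultimately show ?thesis
      unfolding glue_def by (rule equivclp_trans)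
  qed
next
  assume "glue E D e e'"
  then have "glue E D e = glue E D e'"
    unfolding glue_def by (intro ext) (meson equivclp_sym equivclp_trans)
  then show "glue_rep E D e = glue_rep E D e'"
    by (simp add: glue_rep_def)
qed

text \<open>Along a single wire only one pair of edges is identified, so the equivalence closure has
  just one class with two elements.\<close>

lemma glue_single:
  assumes "outs D = [o1]" "ins E = [i1]"
  shows "glue E D e e' \<longleftrightarrow> e = e' \<or> e \<in> {inl o1, inr i1} \<and> e' \<in> {inl o1, inr i1}"
proof
  assume "glue E D e e'"
  then show "e = e' \<or> e \<in> {inl o1, inr i1} \<and> e' \<in> {inl o1, inr i1}"
    unfolding glue_def by (induction rule: equivclp_induct) (auto simp: assms)
next
  have "glue E D (inl o1) (inr i1)"
    unfolding glue_def by (rule r_into_equivclp) (simp add: assms)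
  then show "glue E D e e'"
    if "e = e' \<or> e \<in> {inl o1, inr i1} \<and> e' \<in> {inl o1, inr i1}"
    using that unfolding glue_def by (auto intro: equivclp_sym)
qed

lemma line_iso_comp:
  assumes "line u \<cong> D" "line v \<cong> E"
  shows "line (u @ v) \<cong> E \<odot> D"
proof -
  let ?m = "length u" and ?n = "length v"
  obtain f g where fg: "bij_betw f {..<?m} (verts D)" "bij_betw g {..?m} (edges D)"
    "\<forall>k<?m. label D (f k) = u ! k \<and> legs D (f k) = {#g k, g (Suc k)#}"
    "ins D = [g 0]" "outs D = [g ?m]"
    using assms(1) unfolding line_iso_iff by blast
  obtain f' g' where fg': "bij_betw f' {..<?n} (verts E)" "bij_betw g' {..?n} (edges E)"
    "\<forall>k<?n. label E (f' k) = v ! k \<and> legs E (f' k) = {#g' k, g' (Suc k)#}"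
    "ins E = [g' 0]" "outs E = [g' ?n]"
    using assms(2) unfolding line_iso_iff by blast
  let ?r = "glue_rep E D"
  define F where "F k = (if k < ?m then inl (f k) else inr (f' (k - ?m)))" for k
  \<comment> \<open>The joint edge \<open>k = ?m\<close> has two names in the disjoint union.
    \<open>G\<close> takes the left one; by \<open>joint\<close>, \<open>?r\<close> does not
    distinguish them.\<close>
  define G where "G k = (if k \<le> ?m then inl (g k) else inr (g' (k - ?m)))" for k
  have joint: "?r (inl (g ?m)) = ?r (inr (g' 0))"
    unfolding glue_rep_eq_iff by (simp add: glue_single[OF fg(5) fg'(4)])
  then have G_right: "?r (G (?m + k)) = ?r (inr (g' k))" for k
    by (cases k) (auto simp: G_def)
  have G_right': "?r (G k) = ?r (inr (g' (k - ?m)))" if "k \<ge> ?m" for k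
    using G_right[of "k - ?m"] that by simp
  have inj_f: "f x = f y \<longleftrightarrow> x = y" if "x < ?m" "y < ?m" for x y
    using fg(1) that by (auto simp: bij_betw_def inj_on_def)
  have inj_f': "f' x = f' y \<longleftrightarrow> x = y" if "x < ?n" "y < ?n" for x y
    using fg'(1) that by (auto simp: bij_betw_def inj_on_def)
  have inj_g: "g x = g y \<longleftrightarrow> x = y" if "x \<le> ?m" "y \<le> ?m" for x y
    using fg(2) that by (auto simp: bij_betw_def inj_on_def)
  have inj_g': "g' x = g' y \<longleftrightarrow> x = y" if "x \<le> ?n" "y \<le> ?n" for x y
    using fg'(2) that by (auto simp: bij_betw_def inj_on_def)
  have bij_F: "bij_betw F {..<?m + ?n} (verts (E \<odot> D))"
  proof -
    have "inj_on F {..<?m + ?n}"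
      by (auto simp: inj_on_def F_def inj_f inj_f' sum_encode_eq split: if_splits)
    moreover have "F ` {..<?m + ?n} = inl ` f ` {..<?m} \<union> inr ` f' ` {..<?n}"
    proof -
      have "{..<?m + ?n} = {..<?m} \<union> (+) ?m ` {..<?n}"
        by (auto simp: lessThan_atLeast0)
      then show ?thesis
        by (simp only: image_Un image_image) (simp add: F_def)
    qed
    ultimately show ?thesis
      using fg(1) fg'(1) by (simp add: bij_betw_def zx_comp_def zx_tensor_def)
  qed
  have bij_G: "bij_betw (\<lambda>k. ?r (G k)) {..?m + ?n} (edges (E \<odot> D))"
  proof -
    have "inj_on (\<lambda>k. ?r (G k)) {..?m + ?n}"
      unfolding inj_on_def glue_rep_eq_iff glue_single[OF fg(5) fg'(4)] G_def
      by (auto simp: inj_g inj_g' sum_encode_eq split: if_splits)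
    moreover have "(\<lambda>k. ?r (G k)) ` {..?m + ?n} = ?r ` (inl ` g ` {..?m} \<union> inr ` g' ` {..?n})"
    proof -
      \<comment> \<open>The two ranges overlap in \<open>?m\<close>, the joint edge, which is
        harmless for images.\<close>
      have "{..?m + ?n} = {..?m} \<union> (+) ?m ` {..?n}"
        by (auto simp: atMost_atLeast0)
      then show ?thesis
        by (simp only: image_Un image_image G_right) (simp add: G_def)
    qed
    ultimately show ?thesis
      using fg(2) fg'(2) by (simp add: bij_betw_def zx_comp_def zx_tensor_def)
  qed
  show ?thesis
    unfolding line_iso_iff
  proof (intro exI conjI allI impI)
    show "bij_betw F {..<length (u @ v)} (verts (E \<odot> D))"
      "bij_betw (\<lambda>k. ?r (G k)) {..length (u @ v)} (edges (E \<odot> D))"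
      using bij_F bij_G by simp_all
    fix k assume k: "k < length (u @ v)"
    show "label (E \<odot> D) (F k) = (u @ v) ! k"
      using k fg(3) fg'(3) by (auto simp: zx_comp_def zx_tensor_def F_def nth_append)
    show "legs (E \<odot> D) (F k) = {#?r (G k), ?r (G (Suc k))#}"
    proof (cases "k < ?m")
      case True
      then show ?thesis
        using fg(3) by (simp add: zx_comp_def zx_tensor_def F_def G_def)
    next
      case False
      then show ?thesis
        using k fg'(3) by (simp add: zx_comp_def zx_tensor_def F_def G_right' Suc_diff_le)
    qed
  next
    show "ins (E \<odot> D) = [?r (G 0)]"
      using fg by (simp add: zx_comp_def G_def)
    show "outs (E \<odot> D) = [?r (G (length (u @ v)))]"
      using fg' by (simp add: zx_comp_def G_right)
  qed
qed

section \<open>Rewriting inside a line\<close>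

abbreviation clifford_labels :: "vlabel list \<Rightarrow> bool" where
  "clifford_labels ls \<equiv> \<forall>l\<in>set ls. label_over clifford_angles l"

lemma line_in_ZX_over:
  assumes "\<forall>l\<in>set ls. label_over \<Phi> l"
  shows "line ls \<in> ZX_over \<Phi> 1 1"
proof -
  have "ends (line ls) e = 2" if "e \<le> length ls" for e
  proof -
    \<comment> \<open>Edge \<open>e\<close> lies before vertex \<open>e\<close> and after vertex
      \<open>e - 1\<close>. At the extremities the missing ends are the input and the
      output.\<close>
    have "(\<Sum>v<length ls. count {#v, Suc v#} e)
        = (\<Sum>v<length ls. (if v = e then 1 else 0) + (if Suc v = e then 1 else 0))"
      by (intro sum.cong) auto
    also have "\<dots> = (if e < length ls then 1 else 0) + (if e = 0 then 0 else 1)"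
      using that by (cases e) (auto simp: sum.distrib)
    finally show ?thesis
      using that by (auto simp: ends_def line_def)
  qed
  then show ?thesis
    using assms by (auto simp: ZX_over_def line_def)
qed

lemma zx_equiv_refl: "zx_equiv \<Phi> D D"
  by (simp add: zx_equiv_def)

lemma zx_equiv_sym: "zx_equiv \<Phi> D E \<Longrightarrow> zx_equiv \<Phi> E D"
  unfolding zx_equiv_def by (rule equivclp_sym)

lemma zx_equiv_trans: "zx_equiv \<Phi> D E \<Longrightarrow> zx_equiv \<Phi> E F \<Longrightarrow> zx_equiv \<Phi> D F"
  unfolding zx_equiv_def by (rule equivclp_trans)

lemma zx_equiv_iso: "D \<cong> E \<Longrightarrow> zx_equiv \<Phi> D E"
  unfolding zx_equiv_def by (rule r_into_equivclp) simp

text \<open>The context of the step consists of the two outer lines with no wire passing beside the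
  rewritten part, that is \<open>k = 0\<close>. Concatenation turns the composites back into
  lines.\<close>

lemma line_rewrite:
  assumes rule: "zx_rule \<Phi> L R \<or> (\<exists>L' R'. zx_rule \<Phi> L' R' \<and> L = colour_swap L' \<and> R = colour_swap R')"
    and iso: "line l \<cong> L" "line r \<cong> R"
    and ctxt: "\<forall>x\<in>set a. label_over \<Phi> x" "\<forall>x\<in>set b. label_over \<Phi> x"
  shows "zx_equiv \<Phi> (line (a @ l @ b)) (line (a @ r @ b))"
proof -
  let ?C = "\<lambda>M. line b \<odot> (M \<otimes> zx_id 0) \<odot> line a"
  have in_context: "line (a @ m @ b) \<cong> ?C M" if "line m \<cong> M" for m M
    using line_iso_comp[OF line_iso_comp[OF zx_iso_refl
        zx_iso_trans[OF that iso_tensor_empty_right[OF empty_diagram_id]]] zx_iso_refl]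
    by simp
  have "zx_step \<Phi> (?C L) (?C R)"
    unfolding zx_step_def
  proof (intro exI conjI)
    show "line a \<in> ZX_over \<Phi> 1 (1 + 0)" "line b \<in> ZX_over \<Phi> (1 + 0) 1"
      using ctxt line_in_ZX_over by simp_all
  qed (use rule iso length_ins_line_iso length_outs_line_iso zx_iso_refl in auto)
  then have "zx_equiv \<Phi> (?C L) (?C R)"
    unfolding zx_equiv_def by (intro r_into_equivclp) simp
  then show ?thesis
    using in_context iso zx_equiv_iso zx_equiv_sym zx_equiv_trans by meson
qed

section \<open>The monoid of Clifford words\<close>

text \<open>All lists containing a label that is not a Clifford label are put into one class, an
  absorbing element. This makes the relation a congruence on all lists.\<close>

definition word_equiv :: "vlabel list \<Rightarrow> vlabel list \<Rightarrow> bool" where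
  "word_equiv l r \<longleftrightarrow> (clifford_labels l \<longleftrightarrow> clifford_labels r) \<and>
     (clifford_labels l \<longrightarrow> (\<forall>a b. clifford_labels a \<longrightarrow> clifford_labels b \<longrightarrow>
        line (a @ l @ b) \<leftrightarrow>\<^sup>* line (a @ r @ b)))"

lemma word_equivD:
  "word_equiv l r \<Longrightarrow> clifford_labels l \<Longrightarrow> clifford_labels a \<Longrightarrow> clifford_labels b \<Longrightarrow>
     line (a @ l @ b) \<leftrightarrow>\<^sup>* line (a @ r @ b)"
  by (simp add: word_equiv_def)

lemma equivp_word_equiv: "equivp word_equiv"
proof (rule equivpI)
  show "reflp word_equiv"
    by (auto simp: reflp_def word_equiv_def zx_equiv_refl)
  show "symp word_equiv"
    by (auto simp: symp_def word_equiv_def intro: zx_equiv_sym)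
  show "transp word_equiv"
  proof (rule transpI)
    fix u v w assume "word_equiv u v" "word_equiv v w"
    then show "word_equiv u w"
      using zx_equiv_trans[of _ "line (a @ u @ b)" "line (a @ v @ b)" "line (a @ w @ b)" for a b]
      by (simp add: word_equiv_def)
  qed
qed

quotient_type clifford_word = "vlabel list" / word_equiv
  by (rule equivp_word_equiv)

lift_definition word :: "vlabel list \<Rightarrow> clifford_word" is "\<lambda>l. l" .

instantiation clifford_word :: monoid_mult
begin

lift_definition one_clifford_word :: clifford_word is "[]" .

text \<open>Products are read from input to output, opposite to the order of \<odot>.\<close>

lift_definition times_clifford_word :: "clifford_word \<Rightarrow> clifford_word \<Rightarrow> clifford_word"
  is "(@)"
proof -
  fix u u' v v'
  assume u: "word_equiv u u'" and v: "word_equiv v v'"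
  have "line (a @ (u @ v) @ b) \<leftrightarrow>\<^sup>* line (a @ (u' @ v') @ b)"
    if "clifford_labels (u @ v)" "clifford_labels a" "clifford_labels b" for a b
  proof -
    have labels: "clifford_labels u" "clifford_labels v" "clifford_labels u'"
      using that u by (auto simp: word_equiv_def)
    \<comment> \<open>The factors are replaced one at a time, the other one counting as
      context.\<close>
    have "line (a @ u @ v @ b) \<leftrightarrow>\<^sup>* line (a @ u' @ v @ b)"
      using word_equivD[OF u, of a "v @ b"] that labels by auto
    moreover have "line ((a @ u') @ v @ b) \<leftrightarrow>\<^sup>* line ((a @ u') @ v' @ b)"
      using word_equivD[OF v, of "a @ u'" b] that labels by auto
    ultimately show ?thesis
      using zx_equiv_trans by simp
  qed
  then show "word_equiv (u @ v) (u' @ v')"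
    using u v unfolding word_equiv_def by auto
qed

instance
  by standard (transfer, simp add: equivp_reflp[OF equivp_word_equiv])+

end

lemma word_Nil: "word [] = 1"
  by transfer (rule equivp_reflp[OF equivp_word_equiv])

lemma word_append: "word (u @ v) = word u * word v"
  by transfer (rule equivp_reflp[OF equivp_word_equiv])

lemma word_Cons: "word (l # ls) = word [l] * word ls"
  using word_append[of "[l]" ls] by simp

lemma line_equiv_if_word_eq:
  assumes "word u = word v" "clifford_labels u"
  shows "line u \<leftrightarrow>\<^sup>* line v"
proof -
  have "word_equiv u v"
    using assms(1) by transfer
  then have "line ([] @ u @ []) \<leftrightarrow>\<^sup>* line ([] @ v @ [])"
    using assms(2) by (intro word_equivD) simp_all
  then show ?thesis
    by simp
qed

section \<open>Rewrite rules as equations between words\<close>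

lemma word_eq_if_rule:
  assumes "zx_rule clifford_angles L R" "line l \<cong> L" "line r \<cong> R"
    "clifford_labels l" "clifford_labels r"
  shows "word l = word r"
  using line_rewrite[OF disjI1 assms(2,3)] assms(1,4,5)
  by transfer (simp add: word_equiv_def)

lemma label_over_swap_colour [simp]: "label_over \<Phi> (swap_colour l) \<longleftrightarrow> label_over \<Phi> l"
  by (cases l) auto

text \<open>\<open>zx_rule\<close> lists one colour only. The other is reached by recolouring the
  lines that represent its two sides.\<close>

lemma word_eq_if_rule_swapped:
  assumes "zx_rule clifford_angles L R" "line l \<cong> L" "line r \<cong> R"
    "clifford_labels l" "clifford_labels r"
  shows "word (map swap_colour l) = word (map swap_colour r)"
proof -
  have "zx_equiv clifford_angles (line (a @ map swap_colour l @ b)) (line (a @ map swap_colour r @ b))"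
    if "clifford_labels a" "clifford_labels b" for a b
    using line_rewrite[OF disjI2 line_iso_colour_swap[OF assms(2)] line_iso_colour_swap[OF assms(3)]]
      assms(1) that by blast
  then show ?thesis
    using assms(4,5) by transfer (simp add: word_equiv_def)
qed

section \<open>Arithmetic of Clifford angles and the relations of the monoid\<close>

lemma angle_add: "angle x + angle y = angle (x + y)"
  by transfer (rule equivp_reflp[OF equivp_angle_rel])

lemma angle_minus: "- angle x = angle (- x)"
  by transfer (rule equivp_reflp[OF equivp_angle_rel])

lemma angle_eqI: "x - y = 2 * pi * of_int k \<Longrightarrow> angle x = angle y"
  by transfer (auto simp: angle_rel_def)

lemma angle_0: "angle 0 = 0"
  by transfer (rule equivp_reflp[OF equivp_angle_rel])

lemma clifford_angle_simps:
  "angle (pi/2) + angle (pi/2) = angle pi"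
  "angle pi + angle (pi/2) = angle (3*pi/2)"
  "angle pi + angle pi = 0"
  "- angle (pi/2) = angle (3*pi/2)"
  "- angle pi = angle pi"
  "- angle (3*pi/2) = angle (pi/2)"
proof -
  show "angle (pi/2) + angle (pi/2) = angle pi" "angle pi + angle (pi/2) = angle (3*pi/2)"
    by (simp_all add: angle_add)
  show "angle pi + angle pi = 0"
    unfolding angle_add angle_0[symmetric] by (rule angle_eqI[of _ _ 1]) simp
  show "- angle (pi/2) = angle (3*pi/2)" "- angle pi = angle pi"
    "- angle (3*pi/2) = angle (pi/2)"
    unfolding angle_minus by (rule angle_eqI[of _ _ "-1"], simp)+
qed

lemma clifford_angles_mem [simp]:
  "0 \<in> clifford_angles" "angle (pi/2) \<in> clifford_angles" "angle pi \<in> clifford_angles"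
  "angle (3*pi/2) \<in> clifford_angles"
  by (auto simp: clifford_angles_def angle_0)

text \<open>The third assumption makes the merged word Clifford; the sums that occur later are
  evaluated by \<open>clifford_angle_simps\<close>.\<close>

lemma word_spider:
  assumes "\<alpha> \<in> clifford_angles" "\<beta> \<in> clifford_angles" "\<alpha> + \<beta> \<in> clifford_angles"
  shows "word [ZV \<alpha>] * word [ZV \<beta>] = word [ZV (\<alpha> + \<beta>)]"
    and "word [XV \<alpha>] * word [XV \<beta>] = word [XV (\<alpha> + \<beta>)]"
proof -
  have iso: "line [ZV \<alpha>, ZV \<beta>] \<cong> Zd \<beta> 1 1 \<odot> Zd \<alpha> 1 1"
    using line_iso_comp[OF line_iso_vertex line_iso_vertex, of "ZV \<alpha>" "ZV \<beta>"] by simp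
  show "word [ZV \<alpha>] * word [ZV \<beta>] = word [ZV (\<alpha> + \<beta>)]"
    using word_eq_if_rule[OF zx_rule.spider iso line_iso_vertex] assms
    by (simp add: word_append[symmetric])
  show "word [XV \<alpha>] * word [XV \<beta>] = word [XV (\<alpha> + \<beta>)]"
    using word_eq_if_rule_swapped[OF zx_rule.spider iso line_iso_vertex] assms
    by (simp add: word_append[symmetric])
qed

lemma word_identity: "word [ZV 0] = 1" "word [XV 0] = 1"
  using word_eq_if_rule[OF zx_rule.identity line_iso_vertex line_iso_id]
    word_eq_if_rule_swapped[OF zx_rule.identity line_iso_vertex line_iso_id]
  by (simp_all add: word_Nil)

lemma word_pi_commute:
  assumes "\<alpha> \<in> clifford_angles" "- \<alpha> \<in> clifford_angles"
  shows "word [x_pi] * word [ZV \<alpha>] = word [ZV (- \<alpha>)] * word [x_pi]"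
    and "word [z_pi] * word [XV \<alpha>] = word [XV (- \<alpha>)] * word [z_pi]"
proof -
  \<comment> \<open>The first power is a vertex tensored with \<open>zx_id 0\<close>, hence equal to
    the vertex only up to isomorphism.\<close>
  have pow: "line [x_pi] \<cong> zx_pow (Xd (angle pi) 1 1) 1"
    using zx_iso_trans[OF line_iso_vertex iso_tensor_empty_right[OF empty_diagram_id]] by simp
  have isos: "line [x_pi, ZV \<alpha>] \<cong> Zd \<alpha> 1 1 \<odot> Xd (angle pi) 1 1"
    "line [ZV (- \<alpha>), x_pi] \<cong> zx_pow (Xd (angle pi) 1 1) 1 \<odot> Zd (- \<alpha>) 1 1"
    using line_iso_comp[OF line_iso_vertex line_iso_vertex, of x_pi "ZV \<alpha>"]
      line_iso_comp[OF line_iso_vertex pow, of "ZV (- \<alpha>)"] by simp_all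
  show "word [x_pi] * word [ZV \<alpha>] = word [ZV (- \<alpha>)] * word [x_pi]"
    using word_eq_if_rule[OF zx_rule.pi_commute isos] assms
    by (simp add: word_append[symmetric])
  show "word [z_pi] * word [XV \<alpha>] = word [XV (- \<alpha>)] * word [z_pi]"
    using word_eq_if_rule_swapped[OF zx_rule.pi_commute isos] assms
    by (simp add: word_append[symmetric])
qed

text \<open>The colour swap fixes \<open>HV\<close>, so Euler's rule yields two expressions for it.
  Equating them gives the braid relation.\<close>

lemma word_H_euler:
  "word [HV] = word [z_plus] * (word [x_plus] * word [z_plus])"
  "word [HV] = word [x_plus] * (word [z_plus] * word [x_plus])"
proof -
  have iso: "line [z_plus, x_plus, z_plus]
      \<cong> Zd (angle (pi/2)) 1 1 \<odot> Xd (angle (pi/2)) 1 1 \<odot> Zd (angle (pi/2)) 1 1"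
    using line_iso_comp[OF line_iso_comp[OF line_iso_vertex line_iso_vertex] line_iso_vertex,
        of z_plus x_plus z_plus] by simp
  show "word [HV] = word [z_plus] * (word [x_plus] * word [z_plus])"
    using word_eq_if_rule[OF zx_rule.H_euler line_iso_vertex iso]
    by (simp add: word_append[symmetric])
  show "word [HV] = word [x_plus] * (word [z_plus] * word [x_plus])"
    using word_eq_if_rule_swapped[OF zx_rule.H_euler line_iso_vertex iso]
    by (simp add: word_append[symmetric])
qed

section \<open>Normal forms of Clifford words\<close>

text \<open>Together with the first four assumptions and the braid relation, read from left to right,
  these equations rewrite every word to its normal form.\<close>

lemma clifford_rewrites:
  fixes a b p q :: "'a::monoid_mult"
  assumes "a * a = p" "b * b = q" "p * p = 1" "q * q = 1"
    "p * b = q * (b * p)" "q * a = p * (a * q)" "b * (a * b) = a * (b * a)"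
  shows "q * p = p * q" "a * p = p * a" "b * p = p * (q * b)" "a * q = p * (q * a)" "b * q = q * b"
proof -
  \<comment> \<open>Makes an equation applicable at the head of a longer right-nested
    product.\<close>
  have left: "x * y = z \<Longrightarrow> x * (y * w) = z * w" for x y z w :: 'a
    by (metis mult.assoc)
  show ap: "a * p = p * a" and "b * q = q * b"
    using assms(1,2) by (auto simp: mult.assoc)
  \<comment> \<open>\<open>q\<close> moves past both factors of \<open>a * a = p\<close>. Each
    passage leaves a \<open>p\<close>, and the two cancel.\<close>
  have "q * (a * a) = p * (a * (p * (a * q)))"
    using left[OF assms(6)] assms(6) by (simp add: mult.assoc)
  also have "\<dots> = p * (p * (a * (a * q)))"
    using left[OF ap] by (simp add: mult.assoc)
  also have "\<dots> = p * q"
    using left[OF assms(1)] left[OF assms(3)] by simp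
  finally show qp: "q * p = p * q"
    by (simp add: assms(1))
  \<comment> \<open>This is the assumption on \<open>p * b\<close> multiplied on the left by the
    involution \<open>q\<close>.\<close>
  have "b * p = q * (p * b)"
    using left[OF assms(4)] by (simp add: assms(5))
  also have "\<dots> = p * (q * b)"
    using left[OF qp] by (simp add: mult.assoc)
  finally show "b * p = p * (q * b)" .
  show "a * q = p * (q * a)"
    using left[OF assms(3)] by (simp add: assms(6))
qed

definition C\<^sub>1_words :: "vlabel list set" where
  "C\<^sub>1_words = {
     [],
     [z_plus], [z_pi], [z_minus], [x_plus], [x_pi], [x_minus],
     [z_pi, x_pi], [z_pi, x_minus], [z_pi, x_plus], [x_pi, z_minus], [x_pi, z_plus],
     [z_minus, x_minus], [z_minus, x_plus], [z_plus, x_minus], [z_plus, x_plus],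
     [x_minus, z_minus], [x_minus, z_plus], [x_plus, z_minus], [x_plus, z_plus],
     [z_plus, x_minus, z_minus], [z_plus, x_minus, z_plus], [z_plus, x_plus, z_minus], [z_plus, x_plus, z_plus]}"

lemma C\<^sub>1_eq: "C\<^sub>1 = line ` C\<^sub>1_words"
  by (simp only: C\<^sub>1_def C\<^sub>1_words_def)

text \<open>Labels of the one-qubit generators and their daggers; \<open>z_minus\<close> and
  \<open>x_minus\<close> come from the daggers of \<open>S_gate\<close> and
  \<open>V_gate\<close>.\<close>

definition gate_labels :: "vlabel set" where
  "gate_labels = {z_plus, z_pi, z_minus, x_plus, x_pi, x_minus, HV}"

lemma clifford_labels_gates: "set ls \<subseteq> gate_labels \<Longrightarrow> clifford_labels ls"
  by (auto simp: gate_labels_def)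

text \<open>Each of the 24 normal forms is represented by one of the listed words. Every gate is a
  product of \<open>?a\<close> and \<open>?b\<close>, so closure under these two factors
  suffices.\<close>

lemma word_gate_in_C\<^sub>1:
  assumes w: "w \<in> word ` C\<^sub>1_words" and l: "l \<in> gate_labels"
  shows "w * word [l] \<in> word ` C\<^sub>1_words"
proof -
  let ?a = "word [z_plus]" and ?b = "word [x_plus]" and ?p = "word [z_pi]" and ?q = "word [x_pi]"
  have minus: "word [z_minus] = ?p * ?a" "word [x_minus] = ?q * ?b"
    by (simp_all add: word_spider clifford_angle_simps)
  have base: "?a * ?a = ?p" "?b * ?b = ?q" "?p * ?p = 1" "?q * ?q = 1"
    by (simp_all add: word_spider clifford_angle_simps word_identity)
  have braid: "?b * (?a * ?b) = ?a * (?b * ?a)"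
    using word_H_euler by simp
  \<comment> \<open>Negating the angle pi/2 amounts to adding pi, which by \<open>minus\<close> is
    an extra factor \<open>?p\<close> or \<open>?q\<close>.\<close>
  have "?p * ?b = ?q * (?b * ?p)" "?q * ?a = ?p * (?a * ?q)"
    using word_pi_commute[of "angle (pi/2)"] minus
    by (simp_all add: clifford_angle_simps mult.assoc)
  note rules = base braid clifford_rewrites[OF base this braid]
  have left: "x * y = z \<Longrightarrow> x * (y * u) = z * u" for x y z u :: clifford_word
    by (metis mult.assoc)
  \<comment> \<open>Restricted to at least two labels: \<open>word_Cons\<close> as a rewrite rule
    would keep expanding singletons.\<close>
  have word_Cons_Cons: "word (l # m # ls) = word [l] * word (m # ls)" for l m ls
    by (rule word_Cons)
  note normalize = rules rules[THEN left] word_Cons_Cons word_Nil minus mult.assoc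
  \<comment> \<open>There are 48 products; in each case the product and the candidates are
    normalised until one candidate agrees.\<close>
  have C\<^sub>1_gens: "v * ?a \<in> word ` C\<^sub>1_words" "v * ?b \<in> word ` C\<^sub>1_words"
    if "v \<in> word ` C\<^sub>1_words" for v
    using that unfolding C\<^sub>1_words_def image_insert image_empty
    by (simp_all only: insert_iff empty_iff) (elim disjE; simp add: normalize)+
  have "word [l] \<in> {?a, ?a * ?a, ?a * (?a * ?a), ?b, ?b * ?b, ?b * (?b * ?b), ?a * (?b * ?a)}"
    using l by (auto simp: gate_labels_def minus word_H_euler(1) base rules)
  then show ?thesis
    \<comment> \<open>Left-nested products let \<open>C\<^sub>1_gens\<close> absorb the generators
      one after another.\<close>
    using w by (auto simp: mult.assoc[symmetric] simp del: image_iff intro!: C\<^sub>1_gens)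
qed

lemma word_gates_in_C\<^sub>1: "set ls \<subseteq> gate_labels \<Longrightarrow> word ls \<in> word ` C\<^sub>1_words"
proof (induction ls rule: rev_induct)
  case Nil
  then show ?case
    by (simp add: C\<^sub>1_words_def)
next
  case (snoc l ls)
  then show ?case
    by (simp add: word_append word_gate_in_C\<^sub>1)
qed

section \<open>One-qubit circuits are lines\<close>

lemma negate_gate_label: "l \<in> gate_labels \<Longrightarrow> negate_label l \<in> gate_labels"
  by (auto simp: gate_labels_def clifford_angle_simps)

text \<open>Every generator has as many inputs as outputs, so a circuit \<open>1 \<rightarrow> 1\<close> only passes through
  the objects \<open>0\<close> and \<open>1\<close>; in particular it contains no CNOT.\<close>

lemma T_one_qubit:
  assumes "cliff_type t m n"
  shows "m = n \<and> (m = 0 \<longrightarrow> empty_diagram (T t)) \<and>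
    (m = 1 \<longrightarrow> (\<exists>ls. set ls \<subseteq> gate_labels \<and> line ls \<cong> T t))"
proof -
  have gate: "\<exists>ls. set ls \<subseteq> gate_labels \<and> line ls \<cong> vertex l 1 1" if "l \<in> gate_labels" for l
    using that line_iso_vertex by (intro exI[of _ "[l]"]) simp
  show ?thesis
    using assms
  proof (induction rule: cliff_type.induct)
    case (7 n)
    then show ?case
      using empty_diagram_id line_iso_id by (auto intro: exI[of _ "[]"])
  next
    case (9 f m n g p)
    have "empty_diagram (T g \<odot> T f)" if "empty_diagram (T g)" "empty_diagram (T f)"
      using that by (simp add: empty_diagram_def zx_comp_def zx_tensor_def)
    moreover have "\<exists>ls. set ls \<subseteq> gate_labels \<and> line ls \<cong> T g \<odot> T f"
      if "set u \<subseteq> gate_labels" "line u \<cong> T f" "set v \<subseteq> gate_labels" "line v \<cong> T g" for u v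
      using that line_iso_comp by (intro exI[of _ "u @ v"]) simp
    ultimately show ?case
      using "9.IH" by auto
  next
    case (10 f m n g p q)
    have "empty_diagram (T f \<otimes> T g)" if "empty_diagram (T g)" "empty_diagram (T f)"
      using that by (simp add: empty_diagram_def zx_tensor_def)
    \<comment> \<open>One factor is then empty, and tensoring with it changes the line only by an
      isomorphism.\<close>
    moreover have "m + p = 1 \<longleftrightarrow> m = 1 \<and> p = 0 \<or> m = 0 \<and> p = 1"
      by auto
    ultimately show ?case
      using "10.IH" zx_iso_trans iso_tensor_empty_left iso_tensor_empty_right
      by (auto; blast)
  next
    case (11 f m n)
    have "empty_diagram (zx_dagger (T f))" if "empty_diagram (T f)"
      using that by (simp add: empty_diagram_def zx_dagger_def)
    moreover have "\<exists>ls. set ls \<subseteq> gate_labels \<and> line ls \<cong> zx_dagger (T f)"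
      if "set u \<subseteq> gate_labels" "line u \<cong> T f" for u
      using that line_iso_dagger negate_gate_label
      by (intro exI[of _ "map negate_label (rev u)"]) auto
    ultimately show ?case
      using "11.IH" by auto
  \<comment> \<open>One-qubit generators are single vertices; for \<open>CNOT\<close> and
    \<open>Swap\<close> both implications are vacuous, as \<open>m = 2\<close>.\<close>
  qed (use gate in \<open>auto simp: gate_labels_def\<close>)
qed

theorem proposition4p4:
  fixes t :: cliff
  assumes "t \<in> Cliff 1 1"
  shows "\<exists>c\<in>C\<^sub>1. T t \<leftrightarrow>\<^sup>* c"
proof -
  obtain ls where ls: "set ls \<subseteq> gate_labels" "line ls \<cong> T t"
    using T_one_qubit[of t 1 1] assms by (auto simp: Cliff_def)
  obtain c where c: "c \<in> C\<^sub>1_words" "word ls = word c"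
    using word_gates_in_C\<^sub>1[OF ls(1)] by auto
  have "line ls \<leftrightarrow>\<^sup>* line c"
    using line_equiv_if_word_eq[OF c(2) clifford_labels_gates[OF ls(1)]] .
  then have "T t \<leftrightarrow>\<^sup>* line c"
    using zx_equiv_trans[OF zx_equiv_sym[OF zx_equiv_iso[OF ls(2)]]] by blast
  then show ?thesis
    using c(1) by (auto simp: C\<^sub>1_eq)
qed

end
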